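(* Let $q,n\ge1$, $Q=\{1,\dots,q\}$, $f\in\mathbb{R}^q$ with $0<f_k<1$, $R$ a real $q\times n$ matrix with rows $r^k$, $t=2^q$, and let $(Q_i^+,Q_i^-)$, $i=1,\dots,t$, enumerate all ordered pairs of disjoint (possibly empty) sets with union $Q$. Let $P_D^{(n)}$ be the set of $s\in\mathbb{R}^n$, $s\ge0$, such that for every $k\in Q$ either $-r^ks\ge f_k$ or $r^ks\ge1-f_k$. For $p\in\mathbb{R}^n$ let CGLP$(p)$ be the linear program $\min p\alpha$ over $\alpha\in\mathbb{R}^n$, $u_{ik}\ge0$ subject to $$\alpha+\sum_{k\in Q_i^+}u_{ik}r^k-\sum_{k\in Q_i^-}u_{ik}r^k\ge 0,\qquad \sum_{k\in Q_i^+}f_k u_{ik}+\sum_{k\in Q_i^-}(1-f_k)u_{ik}\ge 1,\qquad i=1,\dots,t.$$ Then the inequality $\bar\alpha s\ge 1$ defines a facet of $\operatorname{conv}P_D^{(n)}$ if and only if there exists $p\in\mathbb{R}^n$ with $p>0$ such that all optimal solutions $(\alpha,u)$ of CGLP$(p)$ have $\alpha=\bar\alpha$.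
   Context: Vector inequalities are componentwise.
   Formalization: The set P_D^(n) is assumed nonempty (equivalently, no row r^k is zero); otherwise conv P_D is empty and has no facets, yet for every p>0 all optimal solutions of CGLP(p) have α=0, so the equivalence fails for ᾱ=0. *)

theory Defs
  imports "HOL-Analysis.Analysis"
begin

text \<open>
  The index set Q is the universe of a finite type \<open>'q\<close> and q is \<open>CARD('q)\<close>; likewise n is
  \<open>CARD('n)\<close>. The order on \<open>real ^ 'n\<close> is componentwise \<open>\<le>\<close>; the library's strict order on
  vectors is not the componentwise one, so strict inequalities are spelled out by components.
\<close>

definition P_D :: "real ^ 'n ^ 'q \<Rightarrow> real ^ 'q \<Rightarrow> (real ^ 'n) set" where
  "P_D R f = {s. 0 \<le> s \<and> (\<forall>k. - (row k R \<bullet> s) \<ge> f $ k \<or> row k R \<bullet> s \<ge> 1 - f $ k)}"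

definition enumerates_splits :: "(nat \<Rightarrow> 'q::finite set) \<Rightarrow> (nat \<Rightarrow> 'q set) \<Rightarrow> bool" where
  "enumerates_splits Qp Qm \<longleftrightarrow>
     bij_betw (\<lambda>i. (Qp i, Qm i)) {1..2 ^ CARD('q)} {(A, B). A \<inter> B = {} \<and> A \<union> B = UNIV}"

text \<open>Only the values \<open>u i k\<close> with \<open>i \<in> {1..2 ^ CARD('q)}\<close> are variables of the program.\<close>

definition cglp_feasible ::
  "real ^ 'n ^ 'q \<Rightarrow> real ^ 'q \<Rightarrow> (nat \<Rightarrow> 'q set) \<Rightarrow> (nat \<Rightarrow> 'q set) \<Rightarrow>
   (real ^ 'n) \<times> (nat \<Rightarrow> 'q \<Rightarrow> real) \<Rightarrow> bool" where
  "cglp_feasible R f Qp Qm = (\<lambda>(\<alpha>, u). \<forall>i\<in>{1..2 ^ CARD('q)}.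
     (\<forall>k. u i k \<ge> 0) \<and>
     \<alpha> + (\<Sum>k\<in>Qp i. u i k *\<^sub>R row k R) - (\<Sum>k\<in>Qm i. u i k *\<^sub>R row k R) \<ge> 0 \<and>
     (\<Sum>k\<in>Qp i. f $ k * u i k) + (\<Sum>k\<in>Qm i. (1 - f $ k) * u i k) \<ge> 1)"

definition cglp_optimal ::
  "real ^ 'n ^ 'q \<Rightarrow> real ^ 'q \<Rightarrow> (nat \<Rightarrow> 'q set) \<Rightarrow> (nat \<Rightarrow> 'q set) \<Rightarrow> real ^ 'n \<Rightarrow>
   (real ^ 'n) \<times> (nat \<Rightarrow> 'q \<Rightarrow> real) \<Rightarrow> bool" where
  "cglp_optimal R f Qp Qm p = is_arg_min (\<lambda>(\<alpha>, u). p \<bullet> \<alpha>) (cglp_feasible R f Qp Qm)"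

definition defines_facet :: "'a::euclidean_space \<Rightarrow> real \<Rightarrow> 'a set \<Rightarrow> bool" where
  "defines_facet a b S \<longleftrightarrow> (\<forall>s\<in>S. a \<bullet> s \<ge> b) \<and> (S \<inter> {s. a \<bullet> s = b}) facet_of S"

end

theory Submission
  imports Defs
begin

text \<open>
  Every nonnegative direction, followed far enough, stays in the disjunctive set, because each
  \<open>r\<^sup>k s\<close> eventually leaves its forbidden interval or is constant. Hence valid inequalities have
  nonnegative coefficients, and by Farkas' lemma for each split the set of feasible \<open>\<alpha>\<close> is
  exactly the set of inequalities \<open>\<alpha> s \<ge> 1\<close> valid on \<open>P_D\<close>. An inequality defines a facet iff
  its tight points span the space. If they do, the sum of a basis of tight points is an
  objective with the unique optimal \<open>\<alpha>\<close>. If they do not, some direction orthogonal to all tight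
  points can be added to and subtracted from \<open>\<alpha>\<close> by a small amount without losing
  validity, so \<open>\<alpha>\<close> is not a unique minimizer for any objective.
\<close>

section \<open>Farkas' lemma\<close>

text \<open>A finitely generated cone is closed, so a point outside it is strictly separated from
  it; the normal of the separating hyperplane then contradicts the hypothesis.\<close>

lemma farkas:
  fixes X :: "'a::euclidean_space set"
  assumes "finite X" and imp: "\<And>y. (\<And>x. x \<in> X \<Longrightarrow> 0 \<le> x \<bullet> y) \<Longrightarrow> 0 \<le> c \<bullet> y"
  shows "c \<in> convex_cone hull X"
proof (rule ccontr)
  let ?C = "convex_cone hull X"
  assume "c \<notin> ?C"
  then obtain a b where ab: "a \<bullet> c < b" "\<And>x. x \<in> ?C \<Longrightarrow> b < a \<bullet> x"
    using separating_hyperplane_closed_point[of ?C c] closed_convex_cone_hull[OF \<open>finite X\<close>]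
      convex_convex_cone_hull by blast
  have "b < 0" using ab(2)[OF convex_cone_hull_contains_0] by simp
  have "0 \<le> x \<bullet> a" if "x \<in> X" for x
  proof (rule ccontr)
    assume "\<not> 0 \<le> x \<bullet> a"
    then have "a \<bullet> x < 0" by (simp add: inner_commute)
    \<comment> \<open>This multiple of \<open>x\<close> lies in the cone and attains the value
      \<open>b\<close> exactly, against strict separation.\<close>
    moreover have "(b / (a \<bullet> x)) *\<^sub>R x \<in> ?C"
      using that \<open>b < 0\<close> \<open>a \<bullet> x < 0\<close>
      by (intro convex_cone_hull_mul hull_inc) (auto simp: divide_nonpos_neg)
    ultimately show False using ab(2) by fastforce
  qed
  then have "0 \<le> c \<bullet> a" by (rule imp)
  then show False using ab(1) \<open>b < 0\<close> by (simp add: inner_commute)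
qed

section \<open>The disjunctive set\<close>

text \<open>A split is recorded by its plus part \<open>P\<close> alone. With the sign moved into
  the row, both alternatives become lower bounds on \<open>split_row P R k\<close>, and the paired
  sums of the linear program merge into one sum over all \<open>k\<close>.\<close>

definition split_row :: "'q set \<Rightarrow> real ^ 'n ^ 'q \<Rightarrow> 'q \<Rightarrow> real ^ 'n" where
  "split_row P R k = (if k \<in> P then - row k R else row k R)"

definition split_rhs :: "'q set \<Rightarrow> real ^ 'q \<Rightarrow> 'q \<Rightarrow> real" where
  "split_rhs P f k = (if k \<in> P then f $ k else 1 - f $ k)"

text \<open>
  Normals of the homogenization, in the variables \<open>(s, \<tau>)\<close> with \<open>\<tau> \<ge> 0\<close>, of the polyhedron
  selected by the split \<open>P = Qp i\<close>. Homogenizing treats empty polyhedra uniformly: their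
  consequences are governed by the points with \<open>\<tau> = 0\<close>.
\<close>

definition split_normals :: "'q::finite set \<Rightarrow> real ^ 'n ^ 'q \<Rightarrow> real ^ 'q \<Rightarrow> ((real ^ 'n) \<times> real) set" where
  "split_normals P R f =
     insert (0, 1) (range (\<lambda>j. (axis j 1, 0)) \<union> range (\<lambda>k. (split_row P R k, - split_rhs P f k)))"

lemma finite_split_normals: "finite (split_normals P R f)"
  by (simp add: split_normals_def)

lemma split_normals_nonneg_iff:
  "(\<forall>x\<in>split_normals P R f. 0 \<le> x \<bullet> (s, t)) \<longleftrightarrow>
     0 \<le> s \<and> 0 \<le> t \<and> (\<forall>k. split_rhs P f k * t \<le> split_row P R k \<bullet> s)"
  by (auto simp: split_normals_def inner_axis' less_eq_vec_def ball_Un)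

lemma P_D_iff_split:
  "s \<in> P_D R f \<longleftrightarrow> 0 \<le> s \<and> (\<exists>P. \<forall>k. split_rhs P f k \<le> split_row P R k \<bullet> s)"
proof
  assume s: "s \<in> P_D R f"
  let ?P = "{k. f $ k \<le> - (row k R \<bullet> s)}"
  have "split_rhs ?P f k \<le> split_row ?P R k \<bullet> s" for k
    using s by (auto simp: P_D_def split_row_def split_rhs_def)
  then show "0 \<le> s \<and> (\<exists>P. \<forall>k. split_rhs P f k \<le> split_row P R k \<bullet> s)"
    using s by (auto simp: P_D_def)
next
  assume "0 \<le> s \<and> (\<exists>P. \<forall>k. split_rhs P f k \<le> split_row P R k \<bullet> s)"
  then obtain P where P: "0 \<le> s" "\<And>k. split_rhs P f k \<le> split_row P R k \<bullet> s" by blast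
  have "- (row k R \<bullet> s) \<ge> f $ k \<or> row k R \<bullet> s \<ge> 1 - f $ k" for k
    using P(2)[of k] by (cases "k \<in> P") (auto simp: split_row_def split_rhs_def)
  then show "s \<in> P_D R f" using P(1) by (auto simp: P_D_def)
qed

lemma P_D_nonneg: "s \<in> P_D R f \<Longrightarrow> 0 \<le> s"
  by (simp add: P_D_def)

text \<open>Dehomogenization of a point with positive last coordinate.\<close>

lemma scale_mem_P_D:
  assumes "0 \<le> s" "0 < t" "\<And>k. split_rhs P f k * t \<le> split_row P R k \<bullet> s"
  shows "(1 / t) *\<^sub>R s \<in> P_D R f"
  unfolding P_D_iff_split using assms
  by (auto simp: less_eq_vec_def field_simps intro!: exI[of _ P])

text \<open>Each of the finitely many disjunctions holds for all large \<open>t\<close>, so they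
  hold together. The bound \<open>m\<close> serves arguments that need a step beyond a threshold;
  elsewhere it is 0.\<close>

lemma P_D_add_ray:
  fixes R :: "real ^ 'n ^ 'q"
  assumes s: "s \<in> P_D R f" and "0 \<le> d" and "0 \<le> m"
  shows "\<exists>t>m. s + t *\<^sub>R d \<in> P_D R f"
proof -
  let ?ok = "\<lambda>k t. - (row k R \<bullet> (s + t *\<^sub>R d)) \<ge> f $ k \<or> row k R \<bullet> (s + t *\<^sub>R d) \<ge> 1 - f $ k"
  have ev: "\<forall>\<^sub>F t in at_top. ?ok k t" for k
  proof -
    let ?a = "row k R \<bullet> s" and ?b = "row k R \<bullet> d"
    consider "?b = 0" | "?b > 0" | "?b < 0" by linarith
    then show ?thesis
    proof cases
      case 1
      then show ?thesis using s by (simp add: P_D_def inner_add_right)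
    next
      case 2
      have "?ok k t" if "t \<ge> (1 - f $ k - ?a) / ?b" for t
        using that 2 by (simp add: inner_add_right field_simps)
      then show ?thesis by (auto simp: eventually_at_top_linorder)
    next
      case 3
      have "?ok k t" if "t \<ge> (f $ k + ?a) / - ?b" for t
      proof -
        have "(f $ k + ?a) \<le> t * - ?b"
          using that 3 pos_divide_le_eq[of "- ?b" "f $ k + ?a" t] by linarith
        then show ?thesis by (simp add: inner_add_right algebra_simps)
      qed
      then show ?thesis by (auto simp: eventually_at_top_linorder)
    qed
  qed
  have "\<forall>\<^sub>F t in at_top. (\<forall>k. ?ok k t) \<and> t > m"
    using ev by (intro eventually_conj eventually_all_finite eventually_gt_at_top) auto
  then obtain t where "\<forall>k. ?ok k t" "t > m"
    using eventually_happens' trivial_limit_at_top_linorder by blast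
  moreover have "0 \<le> s + t *\<^sub>R d"
    using s \<open>0 \<le> d\<close> \<open>0 \<le> m\<close> \<open>t > m\<close> by (auto simp: P_D_def less_eq_vec_def)
  ultimately show ?thesis by (auto simp: P_D_def)
qed

section \<open>Valid inequalities and the projection of the linear program\<close>

definition valid_ineqs :: "real ^ 'n ^ 'q \<Rightarrow> real ^ 'q \<Rightarrow> (real ^ 'n) set" where
  "valid_ineqs R f = {\<alpha>. \<forall>s\<in>P_D R f. 1 \<le> \<alpha> \<bullet> s}"

lemma inner_nonneg_vec:
  fixes x y :: "real ^ 'n"
  shows "0 \<le> x \<Longrightarrow> 0 \<le> y \<Longrightarrow> 0 \<le> x \<bullet> y"
  by (auto simp: inner_vec_def less_eq_vec_def intro!: sum_nonneg)

lemma valid_ineqs_nonneg: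
  fixes R :: "real ^ 'n ^ 'q"
  assumes "\<alpha> \<in> valid_ineqs R f" "P_D R f \<noteq> {}"
  shows "0 \<le> \<alpha>"
proof -
  obtain s where s: "s \<in> P_D R f" using assms(2) by blast
  have "0 \<le> \<alpha> $ j" for j
  proof (rule ccontr)
    assume neg: "\<not> 0 \<le> \<alpha> $ j"
    have "1 \<le> \<alpha> \<bullet> s" using assms(1) s by (auto simp: valid_ineqs_def)
    \<comment> \<open>Beyond this step length along the axis the left-hand side is negative.\<close>
    define m where "m = \<alpha> \<bullet> s / - \<alpha> $ j"
    have "0 \<le> m" using neg \<open>1 \<le> \<alpha> \<bullet> s\<close> by (simp add: m_def divide_nonneg_neg)
    have "0 \<le> (axis j 1 :: real ^ 'n)" by (auto simp: less_eq_vec_def axis_def)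
    then obtain t where t: "t > m" "s + t *\<^sub>R axis j 1 \<in> P_D R f"
      using P_D_add_ray[OF s _ \<open>0 \<le> m\<close>] by blast
    then have "1 \<le> \<alpha> \<bullet> s + t * \<alpha> $ j"
      using assms(1) by (fastforce simp: valid_ineqs_def inner_add_right inner_axis)
    moreover have "\<alpha> \<bullet> s < t * - \<alpha> $ j"
      using t(1) neg pos_divide_less_eq[of "- \<alpha> $ j" "\<alpha> \<bullet> s" t] unfolding m_def by linarith
    ultimately show False by linarith
  qed
  then show ?thesis by (simp add: less_eq_vec_def)
qed

text \<open>Farkas' lemma puts \<open>(\<alpha>, - 1)\<close>, the inequality
  \<open>\<alpha> \<bullet> s \<ge> \<tau>\<close>, in the cone of the split's normals. The
  multipliers are read off because the vectors that possess some form a convex cone containing the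
  normals.\<close>

lemma valid_ineq_multipliers:
  fixes R :: "real ^ 'n ^ 'q"
  assumes \<alpha>: "\<alpha> \<in> valid_ineqs R f" and ne: "P_D R f \<noteq> {}"
  obtains u where "\<And>k. 0 \<le> u k" "0 \<le> \<alpha> - (\<Sum>k\<in>UNIV. u k *\<^sub>R split_row P R k)"
    "1 \<le> (\<Sum>k\<in>UNIV. split_rhs P f k * u k)"
proof -
  \<comment> \<open>Only the rows of the split get explicit multipliers; those of
    \<open>(axis j 1, 0)\<close> and \<open>(0, 1)\<close> appear as the slack of the two
    inequalities.\<close>
  define ok :: "(real ^ 'n) \<times> real \<Rightarrow> ('q \<Rightarrow> real) \<Rightarrow> bool" where
    "ok c u \<longleftrightarrow> (\<forall>k. 0 \<le> u k) \<and> 0 \<le> fst c - (\<Sum>k\<in>UNIV. u k *\<^sub>R split_row P R k)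
      \<and> - snd c \<le> (\<Sum>k\<in>UNIV. split_rhs P f k * u k)" for c u
  let ?T = "{c. \<exists>u. ok c u}"
  have "(\<alpha>, - 1) \<in> convex_cone hull split_normals P R f"
  proof (rule farkas[OF finite_split_normals])
    fix y :: "(real ^ 'n) \<times> real"
    assume y: "\<And>x. x \<in> split_normals P R f \<Longrightarrow> 0 \<le> x \<bullet> y"
    obtain s t where st: "y = (s, t)" by fastforce
    have s: "0 \<le> s" "0 \<le> t" "\<And>k. split_rhs P f k * t \<le> split_row P R k \<bullet> s"
      using y split_normals_nonneg_iff[of P R f s t] by (auto simp: st)
    show "0 \<le> (\<alpha>, - 1) \<bullet> y"
    \<comment> \<open>For \<open>t = 0\<close> the vector \<open>s\<close> is a recession direction,
      possibly of an empty polyhedron, and \<alpha> \<ge> 0 suffices; otherwise rescaling gives a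
      point of \<open>P_D\<close>.\<close>
    proof (cases "t = 0")
      case True
      then show ?thesis
        using inner_nonneg_vec[OF valid_ineqs_nonneg[OF \<alpha> ne] s(1)] by (simp add: st)
    next
      case False
      then have "(1 / t) *\<^sub>R s \<in> P_D R f" using s by (intro scale_mem_P_D) auto
      then have "1 \<le> \<alpha> \<bullet> ((1 / t) *\<^sub>R s)" using \<alpha> by (auto simp only: valid_ineqs_def)
      then show ?thesis using False s(2) by (simp add: st field_simps)
    qed
  qed
  moreover have "convex_cone hull split_normals P R f \<subseteq> ?T"
  proof (rule hull_minimal)
    have "(0, 1) \<in> ?T" by (auto intro!: exI[of _ "\<lambda>_. 0"] simp: ok_def)
    moreover have "(axis j 1, 0) \<in> ?T" for j
      by (auto intro!: exI[of _ "\<lambda>_. 0"] simp: ok_def less_eq_vec_def axis_def)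
    moreover have "(split_row P R k, - split_rhs P f k) \<in> ?T" for k
      by (auto intro!: exI[of _ "\<lambda>i. if i = k then 1 else 0"]
          simp: ok_def if_distrib[of "\<lambda>x. x *\<^sub>R _"] if_distrib[of "\<lambda>x. _ * x"] cong: if_cong)
    ultimately show "split_normals P R f \<subseteq> ?T" unfolding split_normals_def by blast
    show "convex_cone ?T"
      unfolding convex_cone_iff
    proof (intro conjI ballI allI impI)
      show "0 \<in> ?T" by (auto intro!: exI[of _ "\<lambda>_. 0"] simp: ok_def)
    next
      fix c c' assume "c \<in> ?T" "c' \<in> ?T"
      then obtain u u' where u: "ok c u" and u': "ok c' u'" by blast
      have sum: "fst (c + c') - (\<Sum>k\<in>UNIV. (u k + u' k) *\<^sub>R split_row P R k) =
          (fst c - (\<Sum>k\<in>UNIV. u k *\<^sub>R split_row P R k)) +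
          (fst c' - (\<Sum>k\<in>UNIV. u' k *\<^sub>R split_row P R k))"
        by (simp add: scaleR_left_distrib sum.distrib)
      have "- snd c + - snd c' \<le>
          (\<Sum>k\<in>UNIV. split_rhs P f k * u k) + (\<Sum>k\<in>UNIV. split_rhs P f k * u' k)"
        using u u' unfolding ok_def by (intro add_mono) blast+
      then have "- snd (c + c') \<le> (\<Sum>k\<in>UNIV. split_rhs P f k * (u k + u' k))"
        by (simp add: distrib_left sum.distrib)
      moreover have "0 \<le> u k + u' k" for k using u u' unfolding ok_def by (intro add_nonneg_nonneg) blast+
      moreover have "0 \<le> fst (c + c') - (\<Sum>k\<in>UNIV. (u k + u' k) *\<^sub>R split_row P R k)"
        unfolding sum using u u' unfolding ok_def by (intro add_nonneg_nonneg) blast+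
      ultimately have "ok (c + c') (\<lambda>k. u k + u' k)" unfolding ok_def by blast
      then show "c + c' \<in> ?T" by blast
    next
      fix c and a :: real assume "c \<in> ?T" "0 \<le> a"
      then obtain u where u: "ok c u" by blast
      have "0 \<le> a *\<^sub>R (fst c - (\<Sum>k\<in>UNIV. u k *\<^sub>R split_row P R k))"
        using u \<open>0 \<le> a\<close> by (auto simp: ok_def less_eq_vec_def)
      moreover have "a * - snd c \<le> a * (\<Sum>k\<in>UNIV. split_rhs P f k * u k)"
        using u \<open>0 \<le> a\<close> by (intro mult_left_mono) (auto simp: ok_def)
      ultimately have "ok (a *\<^sub>R c) (\<lambda>k. a * u k)"
        using u \<open>0 \<le> a\<close>
        by (auto simp: ok_def scaleR_sum_right sum_distrib_left scaleR_diff_right mult.left_commute)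
      then show "a *\<^sub>R c \<in> ?T" by blast
    qed
  qed
  ultimately have "(\<alpha>, - 1) \<in> ?T" by blast
  then show ?thesis using that by (auto simp: ok_def)
qed

section \<open>Perturbation of valid inequalities\<close>

text \<open>
  Farkas' lemma for the homogenized system extended by \<open>\<alpha> \<bullet> s \<le> \<tau>\<close>; \<open>y\<close> is the multiplier of
  the added inequality. This replaces the vertex-ray description of the convex hull.
\<close>

lemma slack_bound:
  fixes R :: "real ^ 'n ^ 'q"
  assumes \<alpha>: "\<alpha> \<in> valid_ineqs R f" and ne: "P_D R f \<noteq> {}"
    and tight: "\<And>s. s \<in> P_D R f \<Longrightarrow> \<alpha> \<bullet> s = 1 \<Longrightarrow> d \<bullet> s = 0"
    and zero: "\<And>j. \<alpha> $ j = 0 \<Longrightarrow> d $ j = 0"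
  shows "\<exists>y\<ge>0. \<forall>s\<in>P_D R f. - y * (\<alpha> \<bullet> s - 1) \<le> d \<bullet> s"
proof -
  have \<alpha>0: "0 \<le> \<alpha>" by (rule valid_ineqs_nonneg[OF \<alpha> ne])
  define ok where "ok P s \<longleftrightarrow> 0 \<le> s \<and> (\<forall>k. split_rhs P f k \<le> split_row P R k \<bullet> s)" for P s
  have "\<exists>y\<ge>0. \<forall>s. ok P s \<longrightarrow> - y * (\<alpha> \<bullet> s - 1) \<le> d \<bullet> s" for P
  proof -
    let ?X = "insert (- \<alpha>, 1) (split_normals P R f)"
    \<comment> \<open>The desired bound as a property of an arbitrary functional \<open>c\<close>:
      it defines a convex cone containing \<open>?X\<close>, hence also the hull of
      \<open>?X\<close>.\<close>
    let ?T = "{c. \<exists>y\<ge>0. \<forall>s. ok P s \<longrightarrow> - y * (\<alpha> \<bullet> s - 1) \<le> c \<bullet> (s, 1 :: real)}"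
    have "(d, 0) \<in> convex_cone hull ?X"
    proof (rule farkas)
      show "finite ?X" by (simp add: finite_split_normals)
      fix y :: "(real ^ 'n) \<times> real"
      assume y: "\<And>x. x \<in> ?X \<Longrightarrow> 0 \<le> x \<bullet> y"
      obtain s t where st: "y = (s, t)" by fastforce
      have s: "0 \<le> s" "0 \<le> t" "\<And>k. split_rhs P f k * t \<le> split_row P R k \<bullet> s"
        using y split_normals_nonneg_iff[of P R f s t] by (auto simp: st)
      have le: "\<alpha> \<bullet> s \<le> t" using y[of "(- \<alpha>, 1)"] by (simp add: st)
      \<comment> \<open>If \<open>t = 0\<close>, then \<open>s\<close> is supported where \<alpha>
        vanishes, and there \<open>d\<close> vanishes by \<open>zero\<close>. If
        \<open>t > 0\<close>, the rescaled point is forced to be tight.\<close>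
      have "d \<bullet> s = 0"
      proof (cases "t = 0")
        case True
        then have "\<alpha> \<bullet> s = 0" using le inner_nonneg_vec[OF \<alpha>0 s(1)] by simp
        then have "\<alpha> $ j * s $ j = 0" for j
          using \<alpha>0 s(1) by (auto simp: inner_vec_def less_eq_vec_def sum_nonneg_eq_0_iff)
        then have "d $ j * s $ j = 0" for j using zero[of j] by (metis mult_eq_0_iff)
        then show ?thesis by (simp only: inner_vec_def inner_real_def sum.neutral_const)
      next
        case False
        then have mem: "(1 / t) *\<^sub>R s \<in> P_D R f" using s by (intro scale_mem_P_D) auto
        then have "1 \<le> \<alpha> \<bullet> ((1 / t) *\<^sub>R s)" using \<alpha> by (auto simp only: valid_ineqs_def)
        then have "\<alpha> \<bullet> ((1 / t) *\<^sub>R s) = 1" using le False s(2) by (simp add: field_simps)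
        then have "d \<bullet> ((1 / t) *\<^sub>R s) = 0" by (rule tight[OF mem])
        then show ?thesis using False by simp
      qed
      then show "0 \<le> (d, 0) \<bullet> y" by (simp add: st)
    qed
    moreover have "convex_cone hull ?X \<subseteq> ?T"
    proof (rule hull_minimal)
      have "(- \<alpha>, 1) \<in> ?T" by (auto intro!: exI[of _ 1])
      moreover have "x \<in> ?T" if "x \<in> split_normals P R f" for x
      proof -
        have "0 \<le> x \<bullet> (s, 1)" if "ok P s" for s
          using split_normals_nonneg_iff[of P R f s 1] that \<open>x \<in> _\<close> by (auto simp: ok_def)
        then show ?thesis by (auto intro!: exI[of _ 0])
      qed
      ultimately show "?X \<subseteq> ?T" by blast
      show "convex_cone ?T"
        unfolding convex_cone_iff
      proof (intro conjI ballI allI impI)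
        show "0 \<in> ?T" by (auto intro!: exI[of _ 0])
      next
        fix c c' assume "c \<in> ?T" "c' \<in> ?T"
        then obtain y y' where "0 \<le> y" "0 \<le> y'"
          and "\<And>s. ok P s \<Longrightarrow> - y * (\<alpha> \<bullet> s - 1) \<le> c \<bullet> (s, 1)"
          and "\<And>s. ok P s \<Longrightarrow> - y' * (\<alpha> \<bullet> s - 1) \<le> c' \<bullet> (s, 1)" by auto
        then have "\<forall>s. ok P s \<longrightarrow> - (y + y') * (\<alpha> \<bullet> s - 1) \<le> (c + c') \<bullet> (s, 1)"
          unfolding inner_add_left minus_add_distrib distrib_right by (blast intro: add_mono)
        moreover have "0 \<le> y + y'" using \<open>0 \<le> y\<close> \<open>0 \<le> y'\<close> by simp
        ultimately show "c + c' \<in> ?T" by blast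
      next
        fix c and a :: real assume "c \<in> ?T" "0 \<le> a"
        then obtain y where "0 \<le> y" and y: "\<And>s. ok P s \<Longrightarrow> - y * (\<alpha> \<bullet> s - 1) \<le> c \<bullet> (s, 1)"
          by auto
        have "- (a * y) * (\<alpha> \<bullet> s - 1) \<le> (a *\<^sub>R c) \<bullet> (s, 1)" if "ok P s" for s
          using mult_left_mono[OF y[OF that] \<open>0 \<le> a\<close>] by (simp add: mult.assoc)
        then show "a *\<^sub>R c \<in> ?T" using \<open>0 \<le> y\<close> \<open>0 \<le> a\<close> by (auto intro!: exI[of _ "a * y"])
      qed
    qed
    ultimately have "(d, 0) \<in> ?T" by blast
    then show ?thesis by auto
  qed
  then obtain y where y0: "\<And>P. 0 \<le> y P"
    and y: "\<And>P s. ok P s \<Longrightarrow> - y P * (\<alpha> \<bullet> s - 1) \<le> d \<bullet> s" by metis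
  \<comment> \<open>As \<open>\<alpha> \<bullet> s - 1\<close> is nonnegative, the sum of the
    multipliers over all splits works for every split at once.\<close>
  have "- sum y UNIV * (\<alpha> \<bullet> s - 1) \<le> d \<bullet> s" if s: "s \<in> P_D R f" for s
  proof -
    obtain P where "ok P s" using s by (auto simp: P_D_iff_split ok_def)
    have "1 \<le> \<alpha> \<bullet> s" using \<alpha> s by (auto simp: valid_ineqs_def)
    moreover have "y P \<le> sum y UNIV" using y0 by (intro member_le_sum) auto
    ultimately have "y P * (\<alpha> \<bullet> s - 1) \<le> sum y UNIV * (\<alpha> \<bullet> s - 1)"
      by (intro mult_right_mono) auto
    then show ?thesis using y[OF \<open>ok P s\<close>] by simp
  qed
  moreover have "0 \<le> sum y UNIV" using y0 by (simp add: sum_nonneg)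
  ultimately show ?thesis by blast
qed

lemma valid_ineq_perturb:
  fixes R :: "real ^ 'n ^ 'q"
  assumes \<alpha>: "\<alpha> \<in> valid_ineqs R f" and ne: "P_D R f \<noteq> {}"
    and tight: "\<And>s. s \<in> P_D R f \<Longrightarrow> \<alpha> \<bullet> s = 1 \<Longrightarrow> d \<bullet> s = 0"
    and zero: "\<And>j. \<alpha> $ j = 0 \<Longrightarrow> d $ j = 0"
  shows "\<exists>e>0. \<alpha> + e *\<^sub>R d \<in> valid_ineqs R f"
proof -
  obtain y where y: "y \<ge> 0" "\<And>s. s \<in> P_D R f \<Longrightarrow> - y * (\<alpha> \<bullet> s - 1) \<le> d \<bullet> s"
    using slack_bound[OF assms] by blast
  \<comment> \<open>Multiplied by \<open>y + 1\<close>, the slack of the perturbed inequality is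
    \<open>(y + 1) * (\<alpha> \<bullet> s - 1) + d \<bullet> s\<close>, which is at least
    \<open>\<alpha> \<bullet> s - 1\<close>. The summand 1 keeps the denominator positive when
    \<open>y = 0\<close>.\<close>
  have "1 \<le> (\<alpha> + (1 / (y + 1)) *\<^sub>R d) \<bullet> s" if s: "s \<in> P_D R f" for s
  proof -
    have "1 \<le> \<alpha> \<bullet> s" using \<alpha> s by (auto simp: valid_ineqs_def)
    then have "0 \<le> (y + 1) * (\<alpha> \<bullet> s - 1) + d \<bullet> s"
      using y(2)[OF s] by (simp add: algebra_simps)
    then show ?thesis using y(1) by (simp add: inner_add_left field_simps)
  qed
  then show ?thesis
    using y(1) by (intro exI[of _ "1 / (y + 1)"]) (auto simp: valid_ineqs_def)
qed

section \<open>Existence of a minimal valid inequality\<close>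

text \<open>A single row suffices: either alternative bounds
  \<open>\<bar>row k R \<bullet> s\<bar>\<close> below by \<open>m\<close>, and for
  \<open>s \<ge> 0\<close> the triangle inequality moves the absolute values onto the
  coefficients.\<close>

lemma valid_ineqs_nonempty:
  fixes R :: "real ^ 'n ^ 'q"
  assumes f: "\<And>k. 0 < f $ k" "\<And>k. f $ k < 1"
  shows "valid_ineqs R f \<noteq> {}"
proof -
  fix k :: 'q
  define m where "m = min (f $ k) (1 - f $ k)"
  have "0 < m" using f[of k] by (simp add: m_def)
  define \<alpha> :: "real ^ 'n" where "\<alpha> = (\<chi> j. \<bar>row k R $ j\<bar> / m)"
  have "1 \<le> \<alpha> \<bullet> s" if s: "s \<in> P_D R f" for s
  proof -
    have "m \<le> \<bar>row k R \<bullet> s\<bar>" using s by (auto simp: P_D_def m_def dest!: spec[of _ k])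
    also have "\<dots> \<le> (\<Sum>j\<in>UNIV. \<bar>row k R $ j * s $ j\<bar>)" by (simp add: inner_vec_def sum_abs)
    also have "\<dots> = (\<Sum>j\<in>UNIV. m * (\<alpha> $ j * s $ j))"
      using P_D_nonneg[OF s] \<open>0 < m\<close>
      by (intro sum.cong) (auto simp: \<alpha>_def abs_mult less_eq_vec_def)
    also have "\<dots> = m * (\<alpha> \<bullet> s)" by (simp add: inner_vec_def sum_distrib_left)
    finally show ?thesis using \<open>0 < m\<close> by simp
  qed
  then show ?thesis by (auto simp: valid_ineqs_def)
qed

text \<open>Valid inequalities have nonnegative coefficients, so for positive \<open>p\<close> a
  sublevel set of the objective lies in a box and is compact.\<close>

lemma valid_ineqs_attains_min:
  fixes R :: "real ^ 'n ^ 'q"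
  assumes f: "\<And>k. 0 < f $ k" "\<And>k. f $ k < 1" and ne: "P_D R f \<noteq> {}"
    and p: "\<And>j. 0 < p $ j"
  obtains \<alpha> where "\<alpha> \<in> valid_ineqs R f" "\<And>\<beta>. \<beta> \<in> valid_ineqs R f \<Longrightarrow> p \<bullet> \<alpha> \<le> p \<bullet> \<beta>"
proof -
  obtain \<alpha>\<^sub>0 where \<alpha>\<^sub>0: "\<alpha>\<^sub>0 \<in> valid_ineqs R f" using valid_ineqs_nonempty[OF f] by blast
  let ?C = "valid_ineqs R f \<inter> {\<alpha>. p \<bullet> \<alpha> \<le> p \<bullet> \<alpha>\<^sub>0}"
  have "valid_ineqs R f = (\<Inter>s\<in>P_D R f. {\<alpha>. 1 \<le> s \<bullet> \<alpha>})"
    by (auto simp: valid_ineqs_def inner_commute)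
  then have "closed (valid_ineqs R f)"
    by (simp only:) (intro closed_INT ballI closed_halfspace_ge)
  then have "closed ?C" by (rule closed_Int) (rule closed_halfspace_le)
  moreover have "?C \<subseteq> cbox 0 (\<chi> j. p \<bullet> \<alpha>\<^sub>0 / p $ j)"
  proof
    fix \<alpha> assume \<alpha>: "\<alpha> \<in> ?C"
    then have nn: "0 \<le> \<alpha> $ j" for j using valid_ineqs_nonneg[of \<alpha> R f] ne by (simp add: less_eq_vec_def)
    have "p $ j * \<alpha> $ j \<le> p \<bullet> \<alpha>" for j
      unfolding inner_vec_def inner_real_def
      using p nn by (intro member_le_sum) (auto intro: mult_nonneg_nonneg less_imp_le)
    moreover have "p \<bullet> \<alpha> \<le> p \<bullet> \<alpha>\<^sub>0" using \<alpha> by blast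
    ultimately have "p $ j * \<alpha> $ j \<le> p \<bullet> \<alpha>\<^sub>0" for j by (rule order_trans)
    then have "\<alpha> $ j \<le> p \<bullet> \<alpha>\<^sub>0 / p $ j" for j
      using p[of j] by (simp add: pos_le_divide_eq mult.commute)
    then show "\<alpha> \<in> cbox 0 (\<chi> j. p \<bullet> \<alpha>\<^sub>0 / p $ j)" using nn by (simp add: mem_box_cart)
  qed
  ultimately have "compact ?C"
    by (intro compact_eq_bounded_closed[THEN iffD2] conjI bounded_subset[OF bounded_cbox])
  moreover have "?C \<noteq> {}" using \<alpha>\<^sub>0 by blast
  moreover have "continuous_on ?C (\<lambda>\<alpha>. p \<bullet> \<alpha>)" by (intro continuous_intros)
  ultimately have "\<exists>\<alpha>\<in>?C. \<forall>\<beta>\<in>?C. p \<bullet> \<alpha> \<le> p \<bullet> \<beta>"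
    by (rule continuous_attains_inf)
  then obtain \<alpha> where \<alpha>: "\<alpha> \<in> ?C" "\<And>\<beta>. \<beta> \<in> ?C \<Longrightarrow> p \<bullet> \<alpha> \<le> p \<bullet> \<beta>" by blast
  have "p \<bullet> \<alpha> \<le> p \<bullet> \<beta>" if "\<beta> \<in> valid_ineqs R f" for \<beta>
    using \<alpha> that by (cases "\<beta> \<in> ?C") auto
  then show ?thesis using \<alpha>(1) that by blast
qed

section \<open>Projection of the linear program onto \<alpha>\<close>

lemma enumerates_splits_cases:
  assumes "enumerates_splits Qp Qm"
  shows "i \<in> {1..2 ^ CARD('q)} \<Longrightarrow> Qm i = - Qp i"
    and "\<exists>i\<in>{1..2 ^ CARD('q)}. Qp i = (P :: 'q::finite set)"
proof -
  let ?g = "\<lambda>i. (Qp i, Qm i)"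
  have img: "?g ` {1..2 ^ CARD('q)} = {(A, B). A \<inter> B = {} \<and> A \<union> B = UNIV}"
    using assms by (simp add: enumerates_splits_def bij_betw_def)
  show "Qm i = - Qp i" if "i \<in> {1..2 ^ CARD('q)}"
    using imageI[of i _ ?g, OF that, unfolded img] by auto
  have "(P, - P) \<in> ?g ` {1..2 ^ CARD('q)}" unfolding img by auto
  then show "\<exists>i\<in>{1..2 ^ CARD('q)}. Qp i = P" by auto
qed

lemma cglp_feasible_iff:
  fixes R :: "real ^ 'n ^ 'q"
  assumes "enumerates_splits Qp Qm"
  shows "cglp_feasible R f Qp Qm (\<alpha>, u) \<longleftrightarrow> (\<forall>i\<in>{1..2 ^ CARD('q)}.
     (\<forall>k. 0 \<le> u i k) \<and> 0 \<le> \<alpha> - (\<Sum>k\<in>UNIV. u i k *\<^sub>R split_row (Qp i) R k) \<and>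
     1 \<le> (\<Sum>k\<in>UNIV. split_rhs (Qp i) f k * u i k))"
proof -
  have "\<alpha> + (\<Sum>k\<in>Qp i. u i k *\<^sub>R row k R) - (\<Sum>k\<in>Qm i. u i k *\<^sub>R row k R) =
      \<alpha> - (\<Sum>k\<in>UNIV. u i k *\<^sub>R split_row (Qp i) R k)"
    and "(\<Sum>k\<in>Qp i. f $ k * u i k) + (\<Sum>k\<in>Qm i. (1 - f $ k) * u i k) =
      (\<Sum>k\<in>UNIV. split_rhs (Qp i) f k * u i k)"
    if "i \<in> {1..2 ^ CARD('q)}" for i
    using enumerates_splits_cases(1)[OF assms that]
    by (simp_all add: split_row_def split_rhs_def if_distrib[of "\<lambda>x. _ *\<^sub>R x"]
        if_distrib[of "\<lambda>x. x * _"] sum.If_cases sum_negf Compl_eq cong: if_cong)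
  then show ?thesis by (simp only: cglp_feasible_def prod.case cong: ball_cong)
qed

text \<open>Weak duality: a point of \<open>P_D\<close> satisfies the rows of some split, and these
  rows are aggregated with that split's multipliers.\<close>

lemma cglp_feasible_imp_valid:
  fixes R :: "real ^ 'n ^ 'q"
  assumes en: "enumerates_splits Qp Qm" and feas: "cglp_feasible R f Qp Qm (\<alpha>, u)"
  shows "\<alpha> \<in> valid_ineqs R f"
proof -
  have "1 \<le> \<alpha> \<bullet> s" if s: "s \<in> P_D R f" for s
  proof -
    obtain P where P: "\<And>k. split_rhs P f k \<le> split_row P R k \<bullet> s"
      using s by (auto simp: P_D_iff_split)
    obtain i where i: "i \<in> {1..2 ^ CARD('q)}" "Qp i = P"
      using enumerates_splits_cases(2)[OF en] by blast
    have u: "\<And>k. 0 \<le> u i k" "0 \<le> \<alpha> - (\<Sum>k\<in>UNIV. u i k *\<^sub>R split_row P R k)"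
      "1 \<le> (\<Sum>k\<in>UNIV. split_rhs P f k * u i k)"
      using feas i by (auto simp: cglp_feasible_iff[OF en])
    note u(3)
    also have "(\<Sum>k\<in>UNIV. split_rhs P f k * u i k) \<le> (\<Sum>k\<in>UNIV. u i k * (split_row P R k \<bullet> s))"
      using u(1) P by (intro sum_mono) (simp add: mult.commute mult_left_mono)
    also have "\<dots> = (\<Sum>k\<in>UNIV. u i k *\<^sub>R split_row P R k) \<bullet> s"
      by (simp add: inner_sum_left)
    also have "\<dots> \<le> \<alpha> \<bullet> s"
      using inner_nonneg_vec[OF u(2) P_D_nonneg[OF s]] by (simp add: inner_diff_left)
    finally show ?thesis .
  qed
  then show ?thesis by (simp add: valid_ineqs_def)
qed

text \<open>The splits share only \<alpha>, so their multipliers can be chosen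
  independently.\<close>

lemma valid_imp_cglp_feasible:
  fixes R :: "real ^ 'n ^ 'q"
  assumes en: "enumerates_splits Qp Qm" and "P_D R f \<noteq> {}" "\<alpha> \<in> valid_ineqs R f"
  shows "\<exists>u. cglp_feasible R f Qp Qm (\<alpha>, u)"
proof -
  have "\<exists>v. (\<forall>k. 0 \<le> v k) \<and> 0 \<le> \<alpha> - (\<Sum>k\<in>UNIV. v k *\<^sub>R split_row P R k) \<and>
     1 \<le> (\<Sum>k\<in>UNIV. split_rhs P f k * v k)" for P
    by (rule valid_ineq_multipliers[OF assms(3,2), of P]) blast
  then obtain v where v: "\<And>P. (\<forall>k. 0 \<le> v P k) \<and> 0 \<le> \<alpha> - (\<Sum>k\<in>UNIV. v P k *\<^sub>R split_row P R k) \<and>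
     1 \<le> (\<Sum>k\<in>UNIV. split_rhs P f k * v P k)" by metis
  have "cglp_feasible R f Qp Qm (\<alpha>, \<lambda>i. v (Qp i))"
    unfolding cglp_feasible_iff[OF en] by (rule ballI) (rule v)
  then show ?thesis by (intro exI)
qed

text \<open>The objective ignores \<open>u\<close>, so optimality can be tested on the
  projection.\<close>

lemma cglp_optimal_iff:
  assumes en: "enumerates_splits Qp Qm" and ne: "P_D R f \<noteq> {}"
  shows "(\<exists>u. cglp_optimal R f Qp Qm p (\<alpha>, u)) \<longleftrightarrow>
    \<alpha> \<in> valid_ineqs R f \<and> (\<forall>\<beta>\<in>valid_ineqs R f. p \<bullet> \<alpha> \<le> p \<bullet> \<beta>)"
proof -
  have proj: "\<beta> \<in> valid_ineqs R f \<longleftrightarrow> (\<exists>u. cglp_feasible R f Qp Qm (\<beta>, u))" for \<beta>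
    by (rule iffI, erule valid_imp_cglp_feasible[OF en ne], erule exE, erule cglp_feasible_imp_valid[OF en])
  have "cglp_optimal R f Qp Qm p (\<alpha>, u) \<longleftrightarrow> cglp_feasible R f Qp Qm (\<alpha>, u) \<and>
      (\<forall>\<beta> v. cglp_feasible R f Qp Qm (\<beta>, v) \<longrightarrow> p \<bullet> \<alpha> \<le> p \<bullet> \<beta>)" for u
    by (simp add: cglp_optimal_def is_arg_min_linorder)
  then show ?thesis unfolding Ball_def proj by simp
qed

section \<open>Facets\<close>

text \<open>The normal of a hyperplane containing \<open>P_D\<close> would be orthogonal to every
  axis, since some step along each axis stays in \<open>P_D\<close>.\<close>

lemma aff_dim_P_D:
  fixes R :: "real ^ 'n ^ 'q"
  assumes ne: "P_D R f \<noteq> {}"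
  shows "aff_dim (P_D R f) = CARD('n)"
proof (rule ccontr)
  assume "\<not> ?thesis"
  then have "aff_dim (P_D R f) < DIM(real ^ 'n)"
    using aff_dim_le_DIM[of "P_D R f"] by simp
  then obtain a b where ab: "a \<noteq> 0" "P_D R f \<subseteq> {x. a \<bullet> x = b}"
    by (rule aff_lowdim_subset_hyperplane)
  obtain s where s: "s \<in> P_D R f" using ne by blast
  have "a $ j = 0" for j
  proof -
    have "0 \<le> (axis j 1 :: real ^ 'n)" by (auto simp: less_eq_vec_def axis_def)
    then obtain t where "t > 0" "s + t *\<^sub>R axis j 1 \<in> P_D R f"
      using P_D_add_ray[OF s _ order_refl] by blast
    then have "a \<bullet> (s + t *\<^sub>R axis j 1) = a \<bullet> s" using ab(2) s by blast
    then show ?thesis using \<open>t > 0\<close> by (simp add: inner_add_right inner_axis)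
  qed
  then show False using ab(1) by (simp add: vec_eq_iff)
qed

text \<open>The hyperplane misses 0, so adjoining 0 raises the affine dimension by one and turns it
  into the linear dimension.\<close>

lemma span_eq_UNIV_iff_aff_dim:
  fixes F :: "'a::euclidean_space set"
  assumes F: "F \<subseteq> {x. a \<bullet> x = b}" and "b \<noteq> 0"
  shows "span F = UNIV \<longleftrightarrow> aff_dim F = int DIM('a) - 1"
proof -
  have "affine hull F \<subseteq> {x. a \<bullet> x = b}" using F by (intro hull_minimal affine_hyperplane)
  then have "0 \<notin> affine hull F" using \<open>b \<noteq> 0\<close> by auto
  then have "aff_dim F + 1 = aff_dim (insert 0 F)" by (simp add: aff_dim_insert)
  also have "\<dots> = int (dim (insert 0 F))" by (simp add: aff_dim_zero hull_inc)
  also have "\<dots> = int (dim F)" by (metis dim_span span_insert_0)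
  finally show ?thesis using dim_eq_full[of F] by auto
qed

lemma defines_facet_iff_span:
  fixes R :: "real ^ 'n ^ 'q"
  assumes ne: "P_D R f \<noteq> {}"
  shows "defines_facet \<alpha> 1 (convex hull P_D R f) \<longleftrightarrow>
    \<alpha> \<in> valid_ineqs R f \<and> span (convex hull P_D R f \<inter> {s. \<alpha> \<bullet> s = 1}) = UNIV"
proof -
  let ?K = "convex hull P_D R f" and ?F = "convex hull P_D R f \<inter> {s. \<alpha> \<bullet> s = 1}"
  have valid: "(\<forall>s\<in>?K. 1 \<le> \<alpha> \<bullet> s) \<longleftrightarrow> \<alpha> \<in> valid_ineqs R f"
  proof
    assume "\<alpha> \<in> valid_ineqs R f"
    then have "?K \<subseteq> {s. 1 \<le> \<alpha> \<bullet> s}"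
      by (intro hull_minimal) (auto simp: valid_ineqs_def convex_halfspace_ge)
    then show "\<forall>s\<in>?K. 1 \<le> \<alpha> \<bullet> s" by blast
  qed (auto simp: valid_ineqs_def hull_inc)
  have sp: "span ?F = UNIV \<longleftrightarrow> aff_dim ?F = aff_dim ?K - 1"
    using span_eq_UNIV_iff_aff_dim[of ?F \<alpha> 1] by (simp add: aff_dim_convex_hull aff_dim_P_D[OF ne])
  \<comment> \<open>A facet must be nonempty; the empty set spans only 0, which is not the whole
    space.\<close>
  have "?F \<noteq> {}" if "span ?F = UNIV"
  proof
    assume "?F = {}"
    then have "(UNIV :: (real ^ 'n) set) = {0}" using that by simp
    then have "(1 :: real ^ 'n) = 0" by blast
    then show False by simp
  qed
  moreover have "?F face_of ?K" if "\<alpha> \<in> valid_ineqs R f"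
    using that valid by (intro face_of_Int_supporting_hyperplane_ge convex_convex_hull) auto
  ultimately show ?thesis
    unfolding defines_facet_def facet_of_def using valid sp by auto
qed

text \<open>Nonemptiness matters: an empty \<open>P_D\<close> has no facet, while \<alpha> = 0 is
  then the unique optimal \<alpha> for every positive \<open>p\<close>.\<close>

theorem theorem2p8:
  fixes R :: "real ^ 'n ^ 'q" and f :: "real ^ 'q"
    and Qp Qm :: "nat \<Rightarrow> 'q set" and \<alpha>' :: "real ^ 'n"
  assumes "\<And>k. 0 < f $ k" and "\<And>k. f $ k < 1"
    and "enumerates_splits Qp Qm"
    and "P_D R f \<noteq> {}"
  shows "defines_facet \<alpha>' 1 (convex hull (P_D R f)) \<longleftrightarrow>
    (\<exists>p :: real ^ 'n. (\<forall>j. 0 < p $ j) \<and>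
       (\<forall>\<alpha> u. cglp_optimal R f Qp Qm p (\<alpha>, u) \<longrightarrow> \<alpha> = \<alpha>'))"
proof
  let ?V = "valid_ineqs R f" and ?F = "convex hull P_D R f \<inter> {s. \<alpha>' \<bullet> s = 1}"
  note opt = cglp_optimal_iff[OF assms(3,4)]
  {
    assume "defines_facet \<alpha>' 1 (convex hull P_D R f)"
    then have \<alpha>': "\<alpha>' \<in> ?V" and "span ?F = UNIV"
      by (simp_all add: defines_facet_iff_span[OF assms(4)])
    then obtain B where B: "B \<subseteq> ?F" "independent B" "span B = UNIV"
      using basis_exists[of ?F] span_minimal[OF _ subspace_span] by (metis top.extremum_uniqueI)
    have "finite B" using B(2) by (rule independent_imp_finite)
    have pos: "0 \<le> s" if "s \<in> B" for s
    proof -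
      have "convex {s :: real ^ 'n. 0 \<le> s}"
        by (auto simp: convex_def less_eq_vec_def)
      then have "convex hull P_D R f \<subseteq> {s. 0 \<le> s}"
        by (intro hull_minimal) (auto simp: P_D_def)
      then show ?thesis using that B(1) by blast
    qed
    have ge: "1 \<le> s \<bullet> \<beta>" if "s \<in> B" "\<beta> \<in> ?V" for s \<beta>
    proof -
      have "convex hull P_D R f \<subseteq> {s. 1 \<le> \<beta> \<bullet> s}"
        using that(2) by (intro hull_minimal) (auto simp: valid_ineqs_def convex_halfspace_ge)
      then show ?thesis using that B(1) by (auto simp: inner_commute)
    qed
    have eq: "s \<bullet> \<alpha>' = 1" if "s \<in> B" for s using that B(1) by (auto simp: inner_commute)
    \<comment> \<open>Each basis vector has value at least 1 under a valid inequality and exactly 1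
      under \<open>\<alpha>'\<close>. Equality in the sum forces equality on the whole
      basis.\<close>
    let ?p = "\<Sum>B"
    \<comment> \<open>A zero entry would confine the nonnegative basis vectors to a coordinate
      hyperplane.\<close>
    have "0 < ?p $ j" for j
    proof (rule ccontr)
      assume "\<not> 0 < ?p $ j"
      then have "(\<Sum>s\<in>B. s $ j) = 0"
        using pos by (simp add: sum_nonneg less_eq_vec_def order_antisym not_less)
      then have "\<forall>s\<in>B. s $ j = 0"
        using pos \<open>finite B\<close> by (simp add: sum_nonneg_eq_0_iff less_eq_vec_def)
      then have "span B \<subseteq> {s. axis j 1 \<bullet> s = 0}"
        by (intro span_minimal subspace_hyperplane) (auto simp: inner_axis')
      then have "axis j 1 \<bullet> (axis j 1 :: real ^ 'n) = 0" using B(3) by blast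
      then show False by (simp add: inner_axis')
    qed
    moreover have "\<alpha> = \<alpha>'" if "cglp_optimal R f Qp Qm ?p (\<alpha>, u)" for \<alpha> u
    proof -
      have \<alpha>: "\<alpha> \<in> ?V" "?p \<bullet> \<alpha> \<le> ?p \<bullet> \<alpha>'" using opt that \<alpha>' by blast+
      have "(\<Sum>s\<in>B. s \<bullet> \<alpha> - s \<bullet> \<alpha>') \<le> 0"
        using \<alpha>(2) by (simp add: inner_sum_left sum_subtractf)
      moreover have nn: "0 \<le> s \<bullet> \<alpha> - s \<bullet> \<alpha>'" if "s \<in> B" for s
        using ge[OF that \<alpha>(1)] eq[OF that] by simp
      ultimately have "\<forall>s\<in>B. s \<bullet> \<alpha> - s \<bullet> \<alpha>' = 0"
        using \<open>finite B\<close> by (metis (no_types, lifting) order_antisym sum_nonneg sum_nonneg_eq_0_iff)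
      then have "span B \<subseteq> {s. (\<alpha> - \<alpha>') \<bullet> s = 0}"
        by (intro span_minimal subspace_hyperplane)
          (auto simp: inner_diff_left inner_commute[of \<alpha>] inner_commute[of \<alpha>'])
      then have "(\<alpha> - \<alpha>') \<bullet> (\<alpha> - \<alpha>') = 0" using B(3) by blast
      then show ?thesis by simp
    qed
    ultimately show "\<exists>p :: real ^ 'n. (\<forall>j. 0 < p $ j) \<and>
       (\<forall>\<alpha> u. cglp_optimal R f Qp Qm p (\<alpha>, u) \<longrightarrow> \<alpha> = \<alpha>')" by blast
  }
  {
    assume "\<exists>p :: real ^ 'n. (\<forall>j. 0 < p $ j) \<and>
       (\<forall>\<alpha> u. cglp_optimal R f Qp Qm p (\<alpha>, u) \<longrightarrow> \<alpha> = \<alpha>')"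
    then obtain p :: "real ^ 'n" where p: "\<And>j. 0 < p $ j"
      and uniq: "\<And>\<alpha>. \<alpha> \<in> ?V \<Longrightarrow> (\<And>\<beta>. \<beta> \<in> ?V \<Longrightarrow> p \<bullet> \<alpha> \<le> p \<bullet> \<beta>) \<Longrightarrow> \<alpha> = \<alpha>'"
      using opt by blast
    \<comment> \<open>Uniqueness alone could be vacuous; an optimum must exist to be identified with
      \<open>\<alpha>'\<close>.\<close>
    obtain \<alpha> where \<alpha>: "\<alpha> \<in> ?V" "\<And>\<beta>. \<beta> \<in> ?V \<Longrightarrow> p \<bullet> \<alpha> \<le> p \<bullet> \<beta>"
      using valid_ineqs_attains_min[OF assms(1,2,4) p] by blast
    then have "\<alpha> = \<alpha>'" by (rule uniq)
    have \<alpha>': "\<alpha>' \<in> ?V" and less: "\<And>\<beta>. \<beta> \<in> ?V \<Longrightarrow> \<beta> \<noteq> \<alpha>' \<Longrightarrow> p \<bullet> \<alpha>' < p \<bullet> \<beta>"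
      using \<alpha> uniq unfolding \<open>\<alpha> = \<alpha>'\<close> by (blast, meson le_less_linear order_trans)
    \<comment> \<open>Otherwise small moves along both \<open>d\<close> and \<open>- d\<close> stay
      valid, and strict minimality gives \<open>p \<bullet> d\<close> both signs.\<close>
    have rigid: "d = 0"
      if tight: "\<And>s. s \<in> P_D R f \<Longrightarrow> \<alpha>' \<bullet> s = 1 \<Longrightarrow> d \<bullet> s = 0"
        and zero: "\<And>j. \<alpha>' $ j = 0 \<Longrightarrow> d $ j = 0" for d
    proof (rule ccontr)
      assume "d \<noteq> 0"
      obtain e where e: "e > 0" "\<alpha>' + e *\<^sub>R d \<in> ?V"
        using valid_ineq_perturb[OF \<alpha>' assms(4) tight zero] by blast
      obtain e' where e': "e' > 0" "\<alpha>' + e' *\<^sub>R (- d) \<in> ?V"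
        using valid_ineq_perturb[OF \<alpha>' assms(4), of "- d"] tight zero by auto
      have "0 < e * (p \<bullet> d)" using less[OF e(2)] e(1) \<open>d \<noteq> 0\<close> by (simp add: inner_add_right)
      moreover have "e' * (p \<bullet> d) < 0"
        using less[OF e'(2)] e'(1) \<open>d \<noteq> 0\<close> by (simp add: inner_diff_right)
      ultimately show False using e(1) e'(1) by (simp add: zero_less_mult_iff mult_less_0_iff)
    qed
    \<comment> \<open>Without tight points \<open>\<alpha>'\<close> itself would be an admissible
      direction, hence 0, which is not valid.\<close>
    obtain s\<^sub>0 where s\<^sub>0: "s\<^sub>0 \<in> P_D R f" "\<alpha>' \<bullet> s\<^sub>0 = 1"
    proof -
      have "\<alpha>' \<noteq> 0" using \<alpha>' assms(4) by (auto simp: valid_ineqs_def)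
      then show ?thesis using rigid[of \<alpha>'] that by blast
    qed
    have "span ?F = UNIV"
    proof (rule ccontr)
      assume "span ?F \<noteq> UNIV"
      then obtain d where "d \<noteq> 0" and d: "span ?F \<subseteq> {x. d \<bullet> x = 0}"
        using span_not_univ_subset_hyperplane by blast
      have tight: "d \<bullet> s = 0" if "s \<in> P_D R f" "\<alpha>' \<bullet> s = 1" for s
        using d span_base[of s ?F] that by (auto simp: hull_inc)
      \<comment> \<open>Moving from a tight point along an axis with zero coefficient keeps it
        tight, so \<open>d\<close> must vanish on that axis.\<close>
      have "d $ j = 0" if "\<alpha>' $ j = 0" for j
      proof -
        have "0 \<le> (axis j 1 :: real ^ 'n)" by (auto simp: less_eq_vec_def axis_def)
        then obtain t where t: "t > 0" "s\<^sub>0 + t *\<^sub>R axis j 1 \<in> P_D R f"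
          using P_D_add_ray[OF s\<^sub>0(1) _ order_refl] by blast
        have "d \<bullet> (s\<^sub>0 + t *\<^sub>R axis j 1) = 0"
          using t(2) s\<^sub>0(2) that by (intro tight) (simp_all add: inner_add_right inner_axis)
        then show ?thesis using tight[OF s\<^sub>0] t(1) by (simp add: inner_add_right inner_axis)
      qed
      then show False using rigid[OF tight] \<open>d \<noteq> 0\<close> by blast
    qed
    then show "defines_facet \<alpha>' 1 (convex hull P_D R f)"
      using \<alpha>' by (simp add: defines_facet_iff_span[OF assms(4)])
  }
qed

end
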